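(* Let $0<q<1$. For each of the six pairs $(\nabla,\triangle)$ of relations listed below, let $f^{\nabla\triangle}(z)=\sum_{n\ge 0}\tau_{2n+1}^{\nabla\triangle}z^{2n+1}$, where $\tau_{2n+1}^{\nabla\triangle}$ is the probability that a random word $a_1a_2\cdots a_{2n+1}$ with independent geometrically distributed letters satisfies $a_1\nabla a_2\triangle a_3\nabla a_4\triangle\cdots\triangle a_{2n+1}$. Then, as power series in $z$, $$f^{\ge\le}(z)=\frac{\sum_{n\ge0}\frac{(-1)^nz^{2n+1}}{[2n+1]_q!}q^{n(n+1)}}{\sum_{n\ge0}\frac{(-1)^nz^{2n}}{[2n]_q!}q^{n(n-1)}},\qquad f^{\ge<}(z)=\frac{\sum_{n\ge0}\frac{(-1)^nz^{2n+1}}{[2n+1]_q!}}{\sum_{n\ge0}\frac{(-1)^nz^{2n}}{[2n]_q!}},$$ $$f^{><}(z)=\frac{\sum_{n\ge0}\frac{(-1)^nz^{2n+1}}{[2n+1]_q!}q^{n^2}}{\sum_{n\ge0}\frac{(-1)^nz^{2n}}{[2n]_q!}q^{n^2}},\qquad f^{\le\ge}(z)=\frac{\sum_{n\ge0}\frac{(-1)^nz^{2n+1}}{[2n+1]_q!}q^{n^2}}{\sum_{n\ge0}\frac{(-1)^nz^{2n}}{[2n]_q!}q^{n(n-1)}},$$ $$f^{\le>}(z)=\frac{\sum_{n\ge0}\frac{(-1)^nz^{2n+1}}{[2n+1]_q!}}{\sum_{n\ge0}\frac{(-1)^nz^{2n}}{[2n]_q!}},\qquad f^{<>}(z)=\f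rac{\sum_{n\ge0}\frac{(-1)^nz^{2n+1}}{[2n+1]_q!}q^{n(n+1)}}{\sum_{n\ge0}\frac{(-1)^nz^{2n}}{[2n]_q!}q^{n^2}}.$$
   Context: Let $p=1-q$. A random word of length $n$ is $a_1a_2\cdots a_n$ where the letters $a_i\in\{1,2,3,\dots\}$ are independent random variables with $\Pr(a_i=k)=pq^{k-1}$ for $k\ge1$. For relations $\nabla,\triangle$ on integers, the word satisfies the pattern $\nabla\triangle$ if $a_1\nabla a_2$, $a_2\triangle a_3$, $a_3\nabla a_4$, $a_4\triangle a_5$, and so on alternately (for a word of length 1 the condition is empty, so the probability is 1). Notation: $[n]_q=\frac{1-q^n}{1-q}$, $[n]_q!=[1]_q[2]_q\cdots[n]_q$, $[0]_q!=1$. *)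

theory Defs
  imports
    "HOL-Probability.Probability"
    "HOL-Computational_Algebra.Computational_Algebra"
begin

(* geometric_pmf r counts failures and so lives on {0,1,2,...}; the letters start at 1. *)
definition letter_pmf :: "real \<Rightarrow> nat pmf" where
  "letter_pmf q = map_pmf Suc (geometric_pmf (1 - q))"

lemma pmf_letter_pmf:
  assumes "0 < q" "q < 1" "k \<ge> 1"
  shows "pmf (letter_pmf q) k = (1 - q) * q ^ (k - 1)"
proof -
  obtain j where k: "k = Suc j"
    using assms(3) by (cases k) auto
  have "pmf (letter_pmf q) (Suc j) = pmf (geometric_pmf (1 - q)) j"
    unfolding letter_pmf_def by (rule pmf_map_inj') auto
  then show ?thesis
    using assms k by (simp add: mult.commute)
qed

(* Lists are indexed from 0, so the pair (a_1, a_2) of the word has index i = 0. *)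
definition satisfies_pattern ::
  "(nat \<Rightarrow> nat \<Rightarrow> bool) \<Rightarrow> (nat \<Rightarrow> nat \<Rightarrow> bool) \<Rightarrow> nat list \<Rightarrow> bool" where
  "satisfies_pattern R S w \<longleftrightarrow>
     (\<forall>i. Suc i < length w \<longrightarrow>
        (if even i then R (w ! i) (w ! Suc i) else S (w ! i) (w ! Suc i)))"

(* replicate_pmf n P is the law of a list of n independent letters with law P. *)
definition tau ::
  "real \<Rightarrow> (nat \<Rightarrow> nat \<Rightarrow> bool) \<Rightarrow> (nat \<Rightarrow> nat \<Rightarrow> bool) \<Rightarrow> nat \<Rightarrow> real" where
  "tau q R S n =
     measure_pmf.prob (replicate_pmf n (letter_pmf q)) {w. satisfies_pattern R S w}"

definition qbracket :: "real \<Rightarrow> nat \<Rightarrow> real" where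
  "qbracket q n = (1 - q ^ n) / (1 - q)"

definition qfact :: "real \<Rightarrow> nat \<Rightarrow> real" where
  "qfact q n = (\<Prod>k=1..n. qbracket q k)"

(* The formal power series with terms c n * z^(2n+1), respectively c n * z^(2n). *)
definition odd_fps :: "(nat \<Rightarrow> real) \<Rightarrow> real fps" where
  "odd_fps c = Abs_fps (\<lambda>m. if odd m then c (m div 2) else 0)"

definition even_fps :: "(nat \<Rightarrow> real) \<Rightarrow> real fps" where
  "even_fps c = Abs_fps (\<lambda>m. if even m then c (m div 2) else 0)"

definition pattern_gf ::
  "real \<Rightarrow> (nat \<Rightarrow> nat \<Rightarrow> bool) \<Rightarrow> (nat \<Rightarrow> nat \<Rightarrow> bool) \<Rightarrow> real fps" where
  "pattern_gf q R S = odd_fps (\<lambda>n. tau q R S (2 * n + 1))"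

end

theory Submission
  imports Defs
begin

text \<open>
  Write \<open>S'\<close> for the negation of \<open>S\<close>, and let \<open>E(2k)\<close> and \<open>O(2n+1)\<close> be the probabilities of the pattern
  \<open>R S'\<close> in words of even and odd length. Concatenating a word with pattern \<open>R S'\<close> of length \<open>2k\<close>
  and an independent word with pattern \<open>R S\<close> leaves the relation at the junction free. It is
  either \<open>S\<close> or \<open>S'\<close>, so \<open>E(2k) * tau(2n+1-2k)\<close> is a sum of two probabilities of hybrid patterns,
  and the alternating sum over \<open>k\<close> telescopes to \<open>(-1)^n O(2n+1)\<close>. In all six cases \<open>R\<close> and
  \<open>S'\<close> point in the same direction, so \<open>E\<close> and \<open>O\<close> are probabilities of monotone chains, which are
  geometric sums.
\<close>

section \<open>Alternating patterns under prepending and reversal\<close>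

lemma satisfies_pattern_Nil [simp]: "satisfies_pattern R S []"
  by (simp add: satisfies_pattern_def)

lemma satisfies_pattern_Cons:
  "satisfies_pattern R S (x # xs) \<longleftrightarrow> (xs = [] \<or> R x (hd xs)) \<and> satisfies_pattern S R xs"
proof -
  have split: "(\<forall>i. P i) \<longleftrightarrow> P 0 \<and> (\<forall>i. P (Suc i))" for P :: "nat \<Rightarrow> bool"
    by (metis not0_implies_Suc)
  show ?thesis
    unfolding satisfies_pattern_def by (subst split, cases "xs = []") (auto simp: hd_conv_nth)
qed

text \<open>Reversal moves the pair at index \<open>i\<close> to index \<open>n - 2 - i\<close> and
  exchanges its letters. The two indices have the same parity exactly when \<open>n\<close> is even,
  so for odd length the relations also trade places.\<close>

lemma satisfies_pattern_rev:
  "satisfies_pattern R S (rev w) \<longleftrightarrow>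
     (if even (length w) then satisfies_pattern (\<lambda>x y. R y x) (\<lambda>x y. S y x) w
      else satisfies_pattern (\<lambda>x y. S y x) (\<lambda>x y. R y x) w)"
proof -
  define n where "n = length w"
  let ?P = "\<lambda>i. if even i then R (rev w ! i) (rev w ! Suc i) else S (rev w ! i) (rev w ! Suc i)"
  have nth: "rev w ! (n - 2 - i) = w ! Suc i" "rev w ! Suc (n - 2 - i) = w ! i"
    if "i < n - 1" for i
    using that by (auto simp: n_def rev_nth intro!: arg_cong[of _ _ "(!) w"])
  have "satisfies_pattern R S (rev w) \<longleftrightarrow> (\<forall>i<n - 1. ?P i)"
    by (auto simp: satisfies_pattern_def n_def)
  also have "\<dots> \<longleftrightarrow> (\<forall>i<n - 1. ?P (n - 2 - i))"
  proof safe
    fix i assume *: "\<forall>i<n - 1. ?P (n - 2 - i)" "i < n - 1"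
    then have "n - 2 - (n - 2 - i) = i" "n - 2 - i < n - 1" by auto
    with *(1) show "?P i" by metis
  next
    fix i assume *: "\<forall>i<n - 1. ?P i" "i < n - 1"
    then have "n - 2 - i < n - 1" by auto
    with *(1) show "?P (n - 2 - i)" by blast
  qed
  also have "\<dots> \<longleftrightarrow> (\<forall>i<n - 1. if even (n - 2 - i) then R (w ! Suc i) (w ! i) else S (w ! Suc i) (w ! i))"
    by (intro all_cong) (simp only: nth)
  also have "\<dots> \<longleftrightarrow> (if even n then satisfies_pattern (\<lambda>x y. R y x) (\<lambda>x y. S y x) w
      else satisfies_pattern (\<lambda>x y. S y x) (\<lambda>x y. R y x) w)"
    by (auto simp: satisfies_pattern_def n_def[symmetric] less_diff_conv)
  finally show ?thesis by (simp add: n_def)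
qed

section \<open>Words of independent letters\<close>

lemma replicate_pmf_append:
  "replicate_pmf (m + n) P =
     map_pmf (\<lambda>(xs, ys). xs @ ys) (pair_pmf (replicate_pmf m P) (replicate_pmf n P))"
  by (simp add: replicate_pmf_distrib pair_pmf_def map_pmf_def bind_assoc_pmf bind_return_pmf)

lemma map_rev_replicate_pmf: "map_pmf rev (replicate_pmf n P) = replicate_pmf n P"
proof (induction n)
  case (Suc n)
  have "map_pmf rev (replicate_pmf (Suc n) P) =
     P \<bind> (\<lambda>x. map_pmf rev (replicate_pmf n P) \<bind> (\<lambda>xs. return_pmf (xs @ [x])))"
    by (simp add: map_pmf_def bind_assoc_pmf bind_return_pmf)
  \<comment> \<open>The induction hypothesis absorbs \<open>rev\<close>, and independence allows the
    rest of the word to be drawn before the letter \<open>x\<close>.\<close>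
  also have "\<dots> = replicate_pmf n P \<bind> (\<lambda>xs. P \<bind> (\<lambda>x. return_pmf (xs @ [x])))"
    by (subst bind_commute_pmf) (simp add: Suc.IH)
  also have "\<dots> = replicate_pmf (n + 1) P"
    by (simp only: replicate_pmf_distrib) (simp add: bind_assoc_pmf bind_return_pmf)
  finally show ?case by simp
qed simp

lemma length_replicate_pmf: "w \<in> set_pmf (replicate_pmf n P) \<Longrightarrow> length w = n"
  by (simp add: set_replicate_pmf)

lemma prob_replicate_pmf_cong:
  assumes "\<And>w. length w = n \<Longrightarrow> w \<in> A \<longleftrightarrow> w \<in> B"
  shows "measure_pmf.prob (replicate_pmf n P) A = measure_pmf.prob (replicate_pmf n P) B"
  by (intro measure_pmf.finite_measure_eq_AE)
     (auto simp: AE_measure_pmf_iff assms dest: length_replicate_pmf)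

text \<open>Independent letters with a common law make a word and its reversal equidistributed. This
  later reduces decreasing chains to increasing ones.\<close>

lemma tau_even_converse: "even n \<Longrightarrow> tau q R S n = tau q (\<lambda>x y. R y x) (\<lambda>x y. S y x) n"
  and tau_odd_converse: "odd n \<Longrightarrow> tau q R S n = tau q (\<lambda>x y. S y x) (\<lambda>x y. R y x) n"
proof -
  have *: "tau q R S n = measure_pmf.prob (replicate_pmf n (letter_pmf q)) {w. satisfies_pattern R S (rev w)}"
    unfolding tau_def by (subst map_rev_replicate_pmf[symmetric]) (simp add: vimage_def)
  show "even n \<Longrightarrow> tau q R S n = tau q (\<lambda>x y. R y x) (\<lambda>x y. S y x) n"
    unfolding * unfolding tau_def by (intro prob_replicate_pmf_cong) (simp add: satisfies_pattern_rev)
  show "odd n \<Longrightarrow> tau q R S n = tau q (\<lambda>x y. S y x) (\<lambda>x y. R y x) n"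
    unfolding * unfolding tau_def by (intro prob_replicate_pmf_cong) (simp add: satisfies_pattern_rev)
qed

lemma prob_replicate_pmf_take_drop:
  fixes P :: "'a::countable pmf"
  shows "measure_pmf.prob (replicate_pmf (m + n) P) {w. take m w \<in> A \<and> drop m w \<in> B} =
    measure_pmf.prob (replicate_pmf m P) A * measure_pmf.prob (replicate_pmf n P) B"
proof -
  let ?M = "replicate_pmf m P" and ?N = "replicate_pmf n P"
  have "measure_pmf.prob (replicate_pmf (m + n) P) {w. take m w \<in> A \<and> drop m w \<in> B} =
    measure_pmf.prob (pair_pmf ?M ?N) {x. take m (fst x @ snd x) \<in> A \<and> drop m (fst x @ snd x) \<in> B}"
    by (simp add: replicate_pmf_append vimage_def case_prod_unfold)
  \<comment> \<open>Almost surely the first component has length \<open>m\<close>, so cutting the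
    concatenation at \<open>m\<close> recovers both components.\<close>
  also have "\<dots> = measure_pmf.prob (pair_pmf ?M ?N) (A \<times> B)"
    by (intro measure_pmf.finite_measure_eq_AE)
       (auto simp: AE_measure_pmf_iff dest: length_replicate_pmf)
  also have "\<dots> = measure_pmf.prob ?M A * measure_pmf.prob ?N B"
    by (intro measure_pmf_prob_product) auto
  finally show ?thesis .
qed

section \<open>Alternating sums and their power series\<close>

lemma sum_alternating_telescope:
  fixes h :: "nat \<Rightarrow> 'a::comm_ring_1"
  shows "(\<Sum>k<n. (-1) ^ k * (h k + h (Suc k))) = h 0 - (-1) ^ n * h n"
  by (induction n) (auto simp: algebra_simps)

text \<open>The term for \<open>k = 0\<close> is \<open>T n\<close>, which equals
  \<open>h 0\<close>. In the remaining sum each inner \<open>h k\<close> occurs twice with opposite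
  signs, so only \<open>h n\<close> survives.\<close>

lemma alternating_convolution:
  fixes E T h :: "nat \<Rightarrow> 'a::comm_ring_1"
  assumes "E 0 = 1" "h 0 = T n"
    and split: "\<And>k. k < n \<Longrightarrow> E (Suc k) * T (n - Suc k) = h k + h (Suc k)"
  shows "(\<Sum>k\<le>n. (-1) ^ k * E k * T (n - k)) = (-1) ^ n * h n"
proof -
  have "(\<Sum>k\<le>n. (-1) ^ k * E k * T (n - k)) =
      E 0 * T n - (\<Sum>k<n. (-1) ^ k * (E (Suc k) * T (n - Suc k)))"
    unfolding lessThan_Suc_atMost[symmetric] sum.lessThan_Suc_shift
    by (simp add: sum_negf mult.assoc)
  also have "(\<Sum>k<n. (-1) ^ k * (E (Suc k) * T (n - Suc k))) = (\<Sum>k<n. (-1) ^ k * (h k + h (Suc k)))"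
    by (intro sum.cong refl) (simp add: split)
  finally show ?thesis
    by (simp add: sum_alternating_telescope assms)
qed

lemma odd_even_fps_mult:
  "odd_fps a * even_fps b = odd_fps (\<lambda>n. \<Sum>k\<le>n. b k * a (n - k))"
proof (rule fps_ext)
  fix m
  show "fps_nth (odd_fps a * even_fps b) m = fps_nth (odd_fps (\<lambda>n. \<Sum>k\<le>n. b k * a (n - k))) m"
  proof (cases "odd m")
    case True
    then obtain n where m: "m = 2 * n + 1" by (elim oddE)
    have "fps_nth (even_fps b * odd_fps a) m =
       (\<Sum>i=0..m. fps_nth (even_fps b) i * fps_nth (odd_fps a) (m - i))"
      by (rule fps_mult_nth)
    also have "\<dots> = (\<Sum>i\<in>(\<lambda>k. 2 * k) ` {..n}. fps_nth (even_fps b) i * fps_nth (odd_fps a) (m - i))"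
      by (rule sum.mono_neutral_right) (auto simp: even_fps_def m elim!: evenE)
    also have "\<dots> = (\<Sum>k\<le>n. fps_nth (even_fps b) (2 * k) * fps_nth (odd_fps a) (2 * (n - k) + 1))"
      by (subst sum.reindex) (auto simp: inj_on_def m intro!: sum.cong arg_cong[of _ _ "fps_nth (odd_fps a)"])
    finally show ?thesis
      by (simp add: even_fps_def odd_fps_def m mult.commute)
  next
    case False
    then show ?thesis
      by (auto simp: fps_mult_nth even_fps_def odd_fps_def intro!: sum.neutral)
  qed
qed


section \<open>Monotone chains as geometric sums\<close>

lemma expectation_letter_pmf_sums:
  fixes V :: "nat \<Rightarrow> real"
  assumes q: "0 < q" "q < 1" and V: "\<And>j. \<bar>V j\<bar> \<le> C"
  shows "(\<lambda>j. (1 - q) * q ^ j * V (Suc j)) sums measure_pmf.expectation (letter_pmf q) V"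
proof -
  \<comment> \<open>Comparison with a geometric series gives absolute convergence, which is what
    turns the integral over the counting measure into an ordinary series.\<close>
  have "summable (\<lambda>j. norm ((1 - q) * q ^ j * V (Suc j)))"
  proof (rule summable_comparison_test)
    show "\<exists>N. \<forall>j\<ge>N. norm (norm ((1 - q) * q ^ j * V (Suc j))) \<le> (1 - q) * q ^ j * C"
      using q V by (auto simp: abs_mult intro!: mult_left_mono)
    show "summable (\<lambda>j. (1 - q) * q ^ j * C)"
      using q by (intro summable_mult summable_mult2 summable_geometric) auto
  qed
  then have "integrable (count_space UNIV) (\<lambda>j. (1 - q) * q ^ j * V (Suc j))"
    by (simp add: integrable_count_space_nat_iff)
  moreover have "measure_pmf.expectation (letter_pmf q) V = (\<integral>j. (1 - q) * q ^ j * V (Suc j) \<partial>count_space UNIV)"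
  proof -
    have "measure_pmf.expectation (letter_pmf q) V =
        measure_pmf.expectation (geometric_pmf (1 - q)) (\<lambda>j. V (Suc j))"
      by (simp add: letter_pmf_def)
    also have "\<dots> = (\<integral>j. pmf (geometric_pmf (1 - q)) j * V (Suc j) \<partial>count_space UNIV)"
      unfolding measure_pmf_eq_density by (subst integral_density) auto
    also have "\<dots> = (\<integral>j. (1 - q) * q ^ j * V (Suc j) \<partial>count_space UNIV)"
      using q by (simp add: mult_ac)
    finally show ?thesis .
  qed
  ultimately show ?thesis
    by (metis sums_integral_count_space_nat)
qed

lemma prob_replicate_pmf_Suc:
  "measure_pmf.prob (replicate_pmf (Suc n) P) A =
     measure_pmf.expectation P (\<lambda>x. measure_pmf.prob (replicate_pmf n P) {w. x # w \<in> A})"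
proof -
  have "replicate_pmf (Suc n) P = bind_pmf P (\<lambda>x. map_pmf ((#) x) (replicate_pmf n P))"
    by (simp add: map_pmf_def)
  then have "measure_pmf (replicate_pmf (Suc n) P) =
      measure_pmf P \<bind> (\<lambda>x. measure_pmf (map_pmf ((#) x) (replicate_pmf n P)))"
    by (simp only: measure_pmf_bind)
  then have "measure_pmf.prob (replicate_pmf (Suc n) P) A =
      measure_pmf.expectation P (\<lambda>x. measure_pmf.prob (map_pmf ((#) x) (replicate_pmf n P)) A)"
    by (simp add: measure_pmf.measure_bind[where N = "count_space UNIV"] space_subprob_algebra
        prob_space_imp_subprob_space measure_pmf.prob_space_axioms)
  then show ?thesis
    by (simp add: vimage_def)
qed

text \<open>
  The gap \<open>c\<close> between the first two letters of an increasing chain shifts all \<open>n\<close> later letters.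
\<close>
fun chain_exponent :: "nat \<Rightarrow> nat \<Rightarrow> nat \<Rightarrow> nat" where
  "chain_exponent c d 0 = 0"
| "chain_exponent c d (Suc n) = n * c + chain_exponent d c n"

text \<open>The gaps \<open>c\<close> shift \<open>2 * n - 1\<close>, ..., 3, 1 later letters and
  the gaps \<open>d\<close> shift \<open>2 * n - 2\<close>, ..., 4, 2 of them; these numbers add up
  to the two coefficients.\<close>

lemma chain_exponent_even: "chain_exponent c d (2 * n) = c * n\<^sup>2 + d * (n * (n - 1))"
proof (induction n)
  case (Suc n)
  then show ?case
    by (cases n) (auto simp: algebra_simps power2_eq_square)
qed simp

lemma chain_exponent_odd: "chain_exponent c d (2 * n + 1) = c * (n * (n + 1)) + d * n\<^sup>2"
  using chain_exponent_even[of d c n]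
  by (cases n) (auto simp: algebra_simps power2_eq_square)

lemma geometric_tail_sums:
  fixes r :: real
  assumes "\<bar>r\<bar> < 1"
  shows "(\<lambda>j. if m \<le> j then K * r ^ j else 0) sums (K * r ^ m / (1 - r))"
proof -
  have "(\<lambda>j. K * r ^ m * r ^ j) sums (K * r ^ m * (1 / (1 - r)))"
    using assms by (intro sums_mult geometric_sums) auto
  then have "(\<lambda>j. (\<lambda>j. if m \<le> j then K * r ^ j else 0) (j + m)) sums (K * r ^ m / (1 - r))"
    by (simp add: power_add mult_ac)
  then show ?thesis
    by (subst (asm) sums_iff_shift) simp
qed

lemma qfact_Suc: "qfact q (Suc n) = qfact q n * ((1 - q ^ Suc n) / (1 - q))"
  by (simp add: qfact_def qbracket_def)

text \<open>The lower bound \<open>m\<close> makes the induction possible: once the first letter is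
  \<open>Suc j\<close>, the rest is a chain with \<open>c\<close> and \<open>d\<close> exchanged and
  all letters above \<open>j + c\<close>. Summing over \<open>j\<close> from \<open>m\<close> on
  produces the next factor of the \<open>q\<close>-factorial.\<close>

lemma prob_increasing_chain_bounded:
  assumes q: "0 < q" "q < 1"
  shows "measure_pmf.prob (replicate_pmf n (letter_pmf q))
      {w. (w = [] \<or> Suc m \<le> hd w) \<and> satisfies_pattern (\<lambda>x y. x + c \<le> y) (\<lambda>x y. x + d \<le> y) w} =
    q ^ (n * m + chain_exponent c d n) / qfact q n"
proof (induction n arbitrary: m c d)
  case 0
  then show ?case by (simp add: qfact_def)
next
  case (Suc n)
  let ?A = "{w. (w = [] \<or> Suc m \<le> hd w) \<and> satisfies_pattern (\<lambda>x y. x + c \<le> y) (\<lambda>x y. x + d \<le> y) w}"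
  let ?V = "\<lambda>x. measure_pmf.prob (replicate_pmf n (letter_pmf q)) {w. x # w \<in> ?A}"
  \<comment> \<open>The ratio \<open>r\<close> collects one factor \<open>q\<close> from the weight
    of the first letter and \<open>q ^ n\<close> from the bound \<open>j + c\<close> on the other
    \<open>n\<close> letters; \<open>K\<close> holds what does not depend on
    \<open>j\<close>.\<close>
  define r where "r = q ^ Suc n"
  define K where "K = (1 - q) * q ^ (n * c + chain_exponent d c n) / qfact q n"
  have V: "?V (Suc j) = (if m \<le> j then q ^ (n * (j + c) + chain_exponent d c n) / qfact q n else 0)" for j
    using Suc.IH[of "j + c" d c] by (auto simp: satisfies_pattern_Cons)
  have "(\<lambda>j. (1 - q) * q ^ j * ?V (Suc j)) sums measure_pmf.prob (replicate_pmf (Suc n) (letter_pmf q)) ?A"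
    unfolding prob_replicate_pmf_Suc
    using q by (intro expectation_letter_pmf_sums[where C = 1]) auto
  also have "(\<lambda>j. (1 - q) * q ^ j * ?V (Suc j)) = (\<lambda>j. if m \<le> j then K * r ^ j else 0)"
    unfolding V
    by (auto simp: fun_eq_iff K_def r_def power_add power_mult_distrib distrib_left mult_ac simp flip: power_mult)
  finally have "(\<lambda>j. if m \<le> j then K * r ^ j else 0) sums measure_pmf.prob (replicate_pmf (Suc n) (letter_pmf q)) ?A" .
  moreover have "\<bar>r\<bar> < 1"
    using q by (simp add: r_def power_less_one_iff abs_mult power_abs del: power_Suc)
  ultimately have "measure_pmf.prob (replicate_pmf (Suc n) (letter_pmf q)) ?A = K * r ^ m / (1 - r)"
    using geometric_tail_sums sums_unique2 by blast
  also have "\<dots> = q ^ (Suc n * m + chain_exponent c d (Suc n)) / qfact q (Suc n)"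
    by (simp add: K_def r_def qfact_Suc power_add mult_ac del: power_Suc flip: power_mult)
  finally show ?case .
qed

lemma set_letter_pmf: "x \<in> set_pmf (letter_pmf q) \<Longrightarrow> 1 \<le> x"
  by (auto simp: letter_pmf_def)

text \<open>All letters are at least 1, so the bounded chain with \<open>m = 0\<close> is almost
  surely no restriction.\<close>

lemma tau_increasing:
  assumes q: "0 < q" "q < 1"
  shows "tau q (\<lambda>x y. x + c \<le> y) (\<lambda>x y. x + d \<le> y) n = q ^ chain_exponent c d n / qfact q n"
proof -
  have "tau q (\<lambda>x y. x + c \<le> y) (\<lambda>x y. x + d \<le> y) n =
     measure_pmf.prob (replicate_pmf n (letter_pmf q))
      {w. (w = [] \<or> Suc 0 \<le> hd w) \<and> satisfies_pattern (\<lambda>x y. x + c \<le> y) (\<lambda>x y. x + d \<le> y) w}"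
    unfolding tau_def
    by (intro measure_pmf.finite_measure_eq_AE)
       (use set_letter_pmf hd_in_set in \<open>fastforce simp: AE_measure_pmf_iff set_replicate_pmf lists_eq_set\<close>)+
  then show ?thesis
    using prob_increasing_chain_bounded[OF q, of n 0 c d] by simp
qed

section \<open>Hybrid patterns and the alternating identity\<close>

lemma tau_alternating_sum:
  "(\<Sum>k\<le>n. (-1) ^ k * tau q R (\<lambda>x y. \<not> S x y) (2 * k) * tau q R S (2 * (n - k) + 1)) =
     (-1) ^ n * tau q R (\<lambda>x y. \<not> S x y) (2 * n + 1)"
proof -
  let ?S' = "\<lambda>x y. \<not> S x y"
  let ?prob = "measure_pmf.prob (replicate_pmf (2 * n + 1) (letter_pmf q))"
  \<comment> \<open>\<open>G k\<close> is the hybrid pattern: \<open>R S'\<close> on the first \<open>2 k + 2\<close> letters, \<open>R S\<close> from there on.\<close>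
  define G where "G k w i \<longleftrightarrow> (if even i then R (w ! i) (w ! Suc i)
      else if i < 2 * k + 1 then \<not> S (w ! i) (w ! Suc i) else S (w ! i) (w ! Suc i))" for k w i
  define H where "H k = {w. length w = 2 * n + 1 \<and> (\<forall>i<2 * n. G k w i)}" for k
  have "G 0 w i \<longleftrightarrow> (if even i then R (w ! i) (w ! Suc i) else S (w ! i) (w ! Suc i))" for w i
    by (auto simp: G_def)
  then have H_0: "?prob (H 0) = tau q R S (2 * n + 1)"
    unfolding tau_def by (intro prob_replicate_pmf_cong) (simp add: H_def satisfies_pattern_def)
  have "G n w i \<longleftrightarrow> (if even i then R (w ! i) (w ! Suc i) else \<not> S (w ! i) (w ! Suc i))"
    if "i < 2 * n" for w i
    using that by (auto simp: G_def)
  then have H_n: "?prob (H n) = tau q R ?S' (2 * n + 1)"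
    unfolding tau_def by (intro prob_replicate_pmf_cong) (simp add: H_def satisfies_pattern_def)
  have split: "tau q R ?S' (2 * Suc k) * tau q R S (2 * (n - Suc k) + 1) = ?prob (H k) + ?prob (H (Suc k))"
    if "k < n" for k
  proof -
    \<comment> \<open>The bounds \<open>2 * k + 1\<close> and \<open>2 * k + 3\<close> have only one
      odd index between them, namely \<open>2 * k + 1\<close>, the junction of the two
      words.\<close>
    have G_Suc: "G (Suc k) w i \<longleftrightarrow> G k w i" if "i \<noteq> 2 * k + 1" for w i
    proof -
      have "i < 2 * Suc k + 1 \<longleftrightarrow> i < 2 * k + 1" if "odd i"
        using that \<open>i \<noteq> 2 * k + 1\<close> by presburger
      then show ?thesis by (auto simp: G_def)
    qed
    have G_neq: "G (Suc k) w (2 * k + 1) \<longleftrightarrow> \<not> G k w (2 * k + 1)" for w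
      by (simp add: G_def)
    have "tau q R ?S' (2 * Suc k) * tau q R S (2 * (n - Suc k) + 1) =
        measure_pmf.prob (replicate_pmf (2 * Suc k + (2 * (n - Suc k) + 1)) (letter_pmf q))
          {w. take (2 * Suc k) w \<in> {w. satisfies_pattern R ?S' w} \<and> drop (2 * Suc k) w \<in> {w. satisfies_pattern R S w}}"
      unfolding tau_def by (rule prob_replicate_pmf_take_drop[symmetric])
    also have "2 * Suc k + (2 * (n - Suc k) + 1) = 2 * n + 1"
      using \<open>k < n\<close> by simp
    also have "?prob {w. take (2 * Suc k) w \<in> {w. satisfies_pattern R ?S' w} \<and> drop (2 * Suc k) w \<in> {w. satisfies_pattern R S w}}
       = ?prob (H k \<union> H (Suc k))"
    proof (rule prob_replicate_pmf_cong)
      fix w :: "nat list" assume len: "length w = 2 * n + 1"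
      have "satisfies_pattern R ?S' (take (2 * Suc k) w) \<longleftrightarrow> (\<forall>i<2 * k + 1. G k w i)"
        using len \<open>k < n\<close> by (auto simp: satisfies_pattern_def G_def)
      \<comment> \<open>The cut comes after an even number of letters, so indices in the suffix keep
        their parity and its pattern again starts with \<open>R\<close>.\<close>
      moreover have "satisfies_pattern R S (drop (2 * Suc k) w) \<longleftrightarrow> (\<forall>i. 2 * k + 1 < i \<and> i < 2 * n \<longrightarrow> G k w i)"
      proof -
        have "satisfies_pattern R S (drop (2 * Suc k) w) \<longleftrightarrow> (\<forall>i. 2 * Suc k + i < 2 * n \<longrightarrow> G k w (2 * Suc k + i))"
          using len by (auto simp: satisfies_pattern_def G_def less_diff_conv add.commute)
        also have "\<dots> \<longleftrightarrow> (\<forall>i. 2 * k + 1 < i \<and> i < 2 * n \<longrightarrow> G k w i)"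
          by (auto simp: less_iff_Suc_add)
        finally show ?thesis .
      qed
      \<comment> \<open>The two hybrids agree off the junction and are complementary there, so their
        union leaves the junction free.\<close>
      moreover have "w \<in> H k \<union> H (Suc k) \<longleftrightarrow> (\<forall>i<2 * n. i \<noteq> 2 * k + 1 \<longrightarrow> G k w i)"
      proof -
        have "w \<in> H k \<union> H (Suc k) \<longleftrightarrow> (\<forall>i<2 * n. G k w i) \<or> (\<forall>i<2 * n. G (Suc k) w i)"
          using len by (simp add: H_def)
        then show ?thesis
          using G_Suc G_neq by metis
      qed
      moreover have "i < 2 * n \<and> i \<noteq> 2 * k + 1 \<longleftrightarrow> i < 2 * k + 1 \<or> 2 * k + 1 < i \<and> i < 2 * n" for i
        using \<open>k < n\<close> by linarith
      ultimately show "w \<in> {w. take (2 * Suc k) w \<in> {w. satisfies_pattern R ?S' w} \<and> drop (2 * Suc k) w \<in> {w. satisfies_pattern R S w}}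
          \<longleftrightarrow> w \<in> H k \<union> H (Suc k)"
        unfolding mem_Collect_eq by blast
    qed
    also have "?prob (H k \<union> H (Suc k)) = ?prob (H k) + ?prob (H (Suc k))"
    proof (rule measure_pmf.finite_measure_Union)
      have "2 * k + 1 < 2 * n"
        using \<open>k < n\<close> by simp
      then show "H k \<inter> H (Suc k) = {}"
        using G_neq unfolding H_def by blast
    qed auto
    finally show ?thesis .
  qed
  have "tau q R ?S' 0 = 1"
    by (simp add: tau_def)
  then have "(\<Sum>k\<le>n. (-1) ^ k * tau q R ?S' (2 * k) * tau q R S (2 * (n - k) + 1)) = (-1) ^ n * ?prob (H n)"
    by (intro alternating_convolution[where E = "\<lambda>k. tau q R ?S' (2 * k)"
          and T = "\<lambda>m. tau q R S (2 * m + 1)"]) (simp_all only: split H_0 mult_0_right)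
  then show ?thesis
    by (simp only: H_n)
qed

section \<open>Generating functions\<close>

lemma pattern_gf_eq:
  "pattern_gf q R S =
     odd_fps (\<lambda>n. (-1) ^ n * tau q R (\<lambda>x y. \<not> S x y) (2 * n + 1)) /
     even_fps (\<lambda>n. (-1) ^ n * tau q R (\<lambda>x y. \<not> S x y) (2 * n))"
proof -
  let ?E = "even_fps (\<lambda>n. (-1) ^ n * tau q R (\<lambda>x y. \<not> S x y) (2 * n))"
  \<comment> \<open>The constant term is the probability for the empty word, so the denominator is
    nonzero and can be cancelled.\<close>
  have "fps_nth ?E 0 = 1"
    by (simp add: even_fps_def tau_def)
  then have "?E \<noteq> 0"
    by auto
  moreover have "pattern_gf q R S * ?E = odd_fps (\<lambda>n. (-1) ^ n * tau q R (\<lambda>x y. \<not> S x y) (2 * n + 1))"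
    unfolding pattern_gf_def odd_even_fps_mult tau_alternating_sum ..
  ultimately show ?thesis
    using nonzero_mult_div_cancel_right[of ?E "pattern_gf q R S"] by simp
qed

lemma pattern_gf_increasing:
  assumes q: "0 < q" "q < 1"
  shows "pattern_gf q (\<lambda>x y. x + c \<le> y) (\<lambda>x y. \<not> x + d \<le> y) =
     odd_fps (\<lambda>n. (-1) ^ n / qfact q (2 * n + 1) * q ^ (c * (n * (n + 1)) + d * n\<^sup>2)) /
     even_fps (\<lambda>n. (-1) ^ n / qfact q (2 * n) * q ^ (c * n\<^sup>2 + d * (n * (n - 1))))"
  unfolding pattern_gf_eq not_not tau_increasing[OF q] chain_exponent_even chain_exponent_odd
  by simp

text \<open>Reversal turns these chains into increasing ones. It exchanges \<open>c\<close> and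
  \<open>d\<close> for odd lengths only, hence in the numerator but not in the denominator.\<close>

lemma pattern_gf_decreasing:
  assumes q: "0 < q" "q < 1"
  shows "pattern_gf q (\<lambda>x y. y + c \<le> x) (\<lambda>x y. \<not> y + d \<le> x) =
     odd_fps (\<lambda>n. (-1) ^ n / qfact q (2 * n + 1) * q ^ (d * (n * (n + 1)) + c * n\<^sup>2)) /
     even_fps (\<lambda>n. (-1) ^ n / qfact q (2 * n) * q ^ (c * n\<^sup>2 + d * (n * (n - 1))))"
proof -
  have "tau q (\<lambda>x y. y + c \<le> x) (\<lambda>x y. y + d \<le> x) (2 * n) = q ^ (c * n\<^sup>2 + d * (n * (n - 1))) / qfact q (2 * n)" for n
    by (subst tau_even_converse) (simp_all only: tau_increasing[OF q] chain_exponent_even even_mult_iff even_numeral simp_thms)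
  moreover have "tau q (\<lambda>x y. y + c \<le> x) (\<lambda>x y. y + d \<le> x) (2 * n + 1) = q ^ (d * (n * (n + 1)) + c * n\<^sup>2) / qfact q (2 * n + 1)" for n
    by (subst tau_odd_converse) (simp, simp only: tau_increasing[OF q] chain_exponent_odd)
  ultimately show ?thesis
    unfolding pattern_gf_eq not_not by simp
qed

theorem theorem2:
  fixes q :: real
  assumes "0 < q" and "q < 1"
  shows
   "pattern_gf q (\<ge>) (\<le>) =
       odd_fps (\<lambda>n. (-1) ^ n / qfact q (2 * n + 1) * q ^ (n * (n + 1))) /
       even_fps (\<lambda>n. (-1) ^ n / qfact q (2 * n) * q ^ (n * (n - 1))) \<and>
    pattern_gf q (\<ge>) (<) =
       odd_fps (\<lambda>n. (-1) ^ n / qfact q (2 * n + 1)) /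
       even_fps (\<lambda>n. (-1) ^ n / qfact q (2 * n)) \<and>
    pattern_gf q (>) (<) =
       odd_fps (\<lambda>n. (-1) ^ n / qfact q (2 * n + 1) * q ^ n\<^sup>2) /
       even_fps (\<lambda>n. (-1) ^ n / qfact q (2 * n) * q ^ n\<^sup>2) \<and>
    pattern_gf q (\<le>) (\<ge>) =
       odd_fps (\<lambda>n. (-1) ^ n / qfact q (2 * n + 1) * q ^ n\<^sup>2) /
       even_fps (\<lambda>n. (-1) ^ n / qfact q (2 * n) * q ^ (n * (n - 1))) \<and>
    pattern_gf q (\<le>) (>) =
       odd_fps (\<lambda>n. (-1) ^ n / qfact q (2 * n + 1)) /
       even_fps (\<lambda>n. (-1) ^ n / qfact q (2 * n)) \<and>
    pattern_gf q (<) (>) =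
       odd_fps (\<lambda>n. (-1) ^ n / qfact q (2 * n + 1) * q ^ (n * (n + 1))) /
       even_fps (\<lambda>n. (-1) ^ n / qfact q (2 * n) * q ^ n\<^sup>2)"
  \<comment> \<open>A gap 0 encodes a weak and a gap 1 a strict inequality. The second gap describes
    the negation of the second relation, so \<open>d = 1\<close> belongs to a weak and
    \<open>d = 0\<close> to a strict one.\<close>
  using pattern_gf_decreasing[OF assms, of 0 1] pattern_gf_decreasing[OF assms, of 0 0]
    pattern_gf_decreasing[OF assms, of 1 0] pattern_gf_increasing[OF assms, of 0 1]
    pattern_gf_increasing[OF assms, of 0 0] pattern_gf_increasing[OF assms, of 1 0]
  by (simp add: not_le not_less Suc_le_eq)

end
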